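(* Let $r\ge 2$ be an integer. If a digraph $D$ has no $(r-1)$-source set, then $D$ contains $r$ pairwise disjoint $(3r-2)$-kernels.
   Context: All digraphs are finite and have no loops and no multiple (parallel) arcs; directed $2$-cycles are allowed. $V(D)$ and $A(D)$ denote the vertex set and arc set of $D$. For vertices $u,v$, $\operatorname{dist}_D(u,v)$ is the length of a shortest directed path from $u$ to $v$ ($\infty$ if none exists), and for $S\subseteq V(D)$, $\operatorname{dist}_D(S,v)=\min_{s\in S}\operatorname{dist}_D(s,v)$. A set $S\subseteq V(D)$ is independent if there is no arc between any two vertices of $S$. A $q$-kernel of $D$ is an independent set $K\subseteq V(D)$ such that $\operatorname{dist}_D(K,v)\le q$ for every $v\in V(D)$. For $S\subseteq V(D)$, $N^-(S)=\{x\in V(D)\setminus S:\ xy\in A(D)\text{ for some }y\in S\}$ is the set of external in-neighbors of $S$. A non-empty set $S\subseteq V(D)$ is an $s$-source set if $N^-(S)=\emptyset$ and $|S|\le s$. *)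

theory Defs
  imports "Graph_Theory.Arc_Walk" "HOL-Library.Extended_Nat" "HOL-Library.Disjoint_Sets"
begin

text \<open>
  Digraphs here are those of the locale \<^locale>\<open>digraph\<close>: finite, loopless, without
  parallel arcs, with directed 2-cycles allowed. The null digraph is not excluded.
\<close>

text \<open>A path (\<^const>\<open>pre_digraph.apath\<close>) is the list of its arcs, so its length is the length of
  the list. In \<^typ>\<open>enat\<close> the infimum of a nonempty set is attained, and that of the
  empty set is \<open>\<infinity>\<close>.\<close>
definition digraph_dist :: "('a, 'b) pre_digraph \<Rightarrow> 'a \<Rightarrow> 'a \<Rightarrow> enat" where
  "digraph_dist G u v = (INF p \<in> {p. pre_digraph.apath G u p v}. enat (length p))"

definition set_dist :: "('a, 'b) pre_digraph \<Rightarrow> 'a set \<Rightarrow> 'a \<Rightarrow> enat" where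
  "set_dist G S v = (INF s \<in> S. digraph_dist G s v)"

definition independent :: "('a, 'b) pre_digraph \<Rightarrow> 'a set \<Rightarrow> bool" where
  "independent G S \<longleftrightarrow> S \<subseteq> verts G \<and> (\<forall>u \<in> S. \<forall>v \<in> S. \<not> u \<rightarrow>\<^bsub>G\<^esub> v)"

definition q_kernel :: "('a, 'b) pre_digraph \<Rightarrow> nat \<Rightarrow> 'a set \<Rightarrow> bool" where
  "q_kernel G q K \<longleftrightarrow> independent G K \<and> (\<forall>v \<in> verts G. set_dist G K v \<le> enat q)"

definition in_nbrs :: "('a, 'b) pre_digraph \<Rightarrow> 'a set \<Rightarrow> 'a set" where
  "in_nbrs G S = {x \<in> verts G - S. \<exists>y \<in> S. x \<rightarrow>\<^bsub>G\<^esub> y}"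

definition source_set :: "('a, 'b) pre_digraph \<Rightarrow> nat \<Rightarrow> 'a set \<Rightarrow> bool" where
  "source_set G s S \<longleftrightarrow> S \<subseteq> verts G \<and> S \<noteq> {} \<and> in_nbrs G S = {} \<and> card S \<le> s"

end

theory Submission
  imports Defs
begin

text \<open>
  Independence costs only distance 2. By the theorem of Chvatal and Lovasz every induced
  subdigraph has a 2-kernel (\<open>induced_two_kernel\<close>), so if the vertices are coloured such that every
  vertex is reached from each of the \<open>r\<close> colours within distance \<open>3 * r - 4\<close>, then 2-kernels of the
  colour classes are disjoint \<open>(3 * r - 2)\<close>-kernels. What has to be found is such a colouring, with
  no condition on the arcs inside a class (\<open>reaching_colouring\<close>).

  Choose a set \<open>Z\<close> with one vertex in each initial strong component, and let \<open>d v\<close> be the distance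
  from \<open>Z\<close> to \<open>v\<close>. If \<open>v\<close> is coloured by \<open>d v mod r\<close>, then the last \<open>r\<close> vertices of a shortest path
  from \<open>Z\<close> to \<open>v\<close> have all colours as soon as \<open>d v \<ge> r - 1\<close>. The vertices with \<open>d v \<le> r - 2\<close> can be
  served through the \<open>z \<in> Z\<close> in front of them, so it is enough that every colour reaches \<open>z\<close> within
  \<open>2 * r - 2\<close>. Here the hypothesis on source sets enters: at least \<open>r\<close> vertices reach \<open>z\<close> within
  \<open>r - 1\<close> steps (\<open>card_in_ball\<close>). There are two cases.

  \<^item> Some such vertex \<open>x\<close> has \<open>d x \<ge> r - 1\<close>. Then all colours reach \<open>x\<close> within \<open>r - 1\<close> steps, and
    through \<open>x\<close> they reach \<open>z\<close> within \<open>2 * r - 2\<close>.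
  \<^item> All of them have \<open>d x \<le> r - 2\<close>. Then \<open>r\<close> of them are recoloured with \<open>r\<close> different colours, and
    all colours reach \<open>z\<close> within \<open>r - 1\<close>. A recoloured vertex can be among the last \<open>r\<close>
    vertices of a shortest path from \<open>Z\<close> to \<open>v\<close> only if \<open>d v \<le> 2 * r - 3\<close>, and then \<open>v\<close> is close
    enough to \<open>z\<close> to be served through it.

  Recoloured sets of different \<open>z\<close> do not interfere, because no vertex that reaches \<open>z\<close> is reached
  from another element of \<open>Z\<close>.
\<close>

section \<open>Bounded reachability in a relation\<close>

definition reaches_within :: "'a rel \<Rightarrow> nat \<Rightarrow> 'a \<Rightarrow> 'a \<Rightarrow> bool" where
  "reaches_within E n u v \<longleftrightarrow> (\<exists>k\<le>n. (u, v) \<in> E ^^ k)"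

lemma reaches_withinI: "(u, v) \<in> E ^^ k \<Longrightarrow> k \<le> n \<Longrightarrow> reaches_within E n u v"
  by (auto simp: reaches_within_def)

lemma reaches_within_refl: "reaches_within E n u u"
  by (rule reaches_withinI[where k = 0]) auto

lemma reaches_within_mono: "reaches_within E m u v \<Longrightarrow> m \<le> n \<Longrightarrow> reaches_within E n u v"
  unfolding reaches_within_def by (meson order_trans)

lemma reaches_within_step: "(u, v) \<in> E \<Longrightarrow> reaches_within E 1 u v"
  by (rule reaches_withinI[where k = 1]) auto

lemma reaches_within_trans:
  assumes "reaches_within E m u v" and "reaches_within E n v w"
  shows "reaches_within E (m + n) u w"
proof -
  obtain j k where "j \<le> m" "(u, v) \<in> E ^^ j" "k \<le> n" "(v, w) \<in> E ^^ k"
    using assms by (auto simp: reaches_within_def)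
  then have "(u, w) \<in> E ^^ (j + k)" "j + k \<le> m + n"
    by (auto simp: relpow_add)
  then show ?thesis by (rule reaches_withinI)
qed

lemma reaches_within_imp_rtrancl: "reaches_within E n u v \<Longrightarrow> (u, v) \<in> E\<^sup>*"
  by (auto simp: reaches_within_def intro: relpow_imp_rtrancl)

lemma reaches_within_source:
  assumes "E \<subseteq> V \<times> V" and "v \<in> V" and "reaches_within E n u v"
  shows "u \<in> V"
proof -
  have "(u, v) \<in> E\<^sup>*" using assms(3) by (rule reaches_within_imp_rtrancl)
  then show ?thesis using assms(1,2) by (cases rule: converse_rtranclE) auto
qed

text \<open>
  As long as the in-ball around \<open>z\<close> is not closed under in-neighbours, it gains a vertex when the
  radius increases by one; once it is closed, its size is at least \<open>r\<close> by hypothesis.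
\<close>
lemma card_in_ball:
  assumes "finite V" and "E \<subseteq> V \<times> V" and "z \<in> V"
    and closed: "\<And>S. S \<subseteq> V \<Longrightarrow> S \<noteq> {} \<Longrightarrow> E\<inverse> `` S \<subseteq> S \<Longrightarrow> r \<le> card S"
  shows "min r (Suc n) \<le> card {x. reaches_within E n x z}"
proof (induction n)
  case 0
  have "{x. reaches_within E 0 x z} = {z}" by (auto simp: reaches_within_def)
  then show ?case by simp
next
  case (Suc n)
  let ?B = "\<lambda>n. {x. reaches_within E n x z}"
  have inV: "?B m \<subseteq> V" for m
    using reaches_within_source[OF assms(2,3)] by auto
  have fin: "finite (?B m)" for m
    using inV assms(1) by (rule finite_subset)
  have sub: "?B n \<subseteq> ?B (Suc n)" by (auto intro: reaches_within_mono)
  show ?case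
  proof (cases "E\<inverse> `` ?B n \<subseteq> ?B n")
    case True
    have "z \<in> ?B n" by (simp add: reaches_within_refl)
    then have "r \<le> card (?B n)" using closed[OF inV _ True] by blast
    also have "\<dots> \<le> card (?B (Suc n))" using sub fin by (intro card_mono)
    finally show ?thesis by simp
  next
    case False
    then obtain x y where xy: "(x, y) \<in> E" "reaches_within E n y z" "\<not> reaches_within E n x z" by auto
    have "reaches_within E 1 x y" using xy(1) by (rule reaches_within_step)
    then have "reaches_within E (Suc n) x z" using reaches_within_trans[of E 1 x y n z] xy(2) by simp
    then have "?B n \<subset> ?B (Suc n)" using sub xy(3) by blast
    then have "card (?B n) < card (?B (Suc n))" using fin by (intro psubset_card_mono)
    then show ?thesis using Suc.IH by linarith
  qed
qed

section \<open>Two-kernels of induced subdigraphs\<close>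

text \<open>
  The classical induction of Chvatal and Lovasz: remove a vertex \<open>v\<close> of \<open>C\<close> and its
  out-neighbours, and take a 2-kernel \<open>K\<close> of the rest. If \<open>K\<close> has an arc into \<open>v\<close>, then \<open>K\<close>
  reaches the removed vertices within 2. If not, then \<open>v\<close> can be added to \<open>K\<close>.
\<close>
lemma induced_two_kernel:
  assumes "finite C" and irr: "\<And>x. (x, x) \<notin> E"
  shows "\<exists>K\<subseteq>C. (\<forall>u\<in>K. \<forall>v\<in>K. (u, v) \<notin> E) \<and> (\<forall>v\<in>C. \<exists>u\<in>K. reaches_within E 2 u v)"
  using assms(1)
proof (induction C rule: finite_psubset_induct)
  case (psubset C)
  show ?case
  proof (cases "C = {}")
    case False
    then obtain v where v: "v \<in> C" by blast
    let ?C = "C - insert v (E `` {v})"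
    have "?C \<subset> C" using v by blast
    then obtain K where K: "K \<subseteq> ?C" "\<forall>x\<in>K. \<forall>y\<in>K. (x, y) \<notin> E"
        "\<forall>x\<in>?C. \<exists>u\<in>K. reaches_within E 2 u x"
      using psubset.IH by meson
    have out: "reaches_within E 1 v x" if "(v, x) \<in> E" for x
      using that by (rule reaches_within_step)
    show ?thesis
    proof (cases "\<exists>u\<in>K. (u, v) \<in> E")
      case True
      then obtain u where u: "u \<in> K" "(u, v) \<in> E" by blast
      have uv: "reaches_within E 1 u v" using u(2) by (rule reaches_within_step)
      have "reaches_within E 2 u x" if "x = v \<or> (v, x) \<in> E" for x
        using that reaches_within_mono[OF uv, of 2] reaches_within_trans[OF uv out, of x]
        by (auto simp: numeral_2_eq_2)
      then have "\<forall>x\<in>C. \<exists>u\<in>K. reaches_within E 2 u x" using K(3) u(1) by blast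
      then show ?thesis using K(1,2) by blast
    next
      case False
      have "\<forall>x\<in>insert v K. \<forall>y\<in>insert v K. (x, y) \<notin> E"
        using K(1,2) False irr by blast
      moreover have "\<forall>x\<in>C. \<exists>u\<in>insert v K. reaches_within E 2 u x"
        using K(3) reaches_within_refl[of E 2 v] reaches_within_mono[OF out, of _ 2] by auto
      moreover have "insert v K \<subseteq> C" using K(1) v by blast
      ultimately show ?thesis by meson
    qed
  qed simp
qed

section \<open>Roots and depth\<close>

text \<open>
  Among the sets from which everything is reached, one of least cardinality will do: if one of its
  elements reached another, the latter could be dropped. Such a set consists of one vertex from each
  initial strong component.
\<close>
lemma independent_roots:
  assumes "finite V"
  obtains Z where "Z \<subseteq> V" "V \<subseteq> E\<^sup>* `` Z"
    "\<And>y z. y \<in> Z \<Longrightarrow> z \<in> Z \<Longrightarrow> (y, z) \<in> E\<^sup>* \<Longrightarrow> y = z"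
proof -
  let ?P = "\<lambda>Z. Z \<subseteq> V \<and> V \<subseteq> E\<^sup>* `` Z"
  have "?P V" by auto
  from ex_has_least_nat[of ?P, OF this, of card] obtain Z
    where Z: "Z \<subseteq> V" "V \<subseteq> E\<^sup>* `` Z" and least: "\<And>Y. ?P Y \<Longrightarrow> card Z \<le> card Y"
    by meson
  have "y = z" if yz: "y \<in> Z" "z \<in> Z" "(y, z) \<in> E\<^sup>*" for y z
  proof (rule ccontr)
    assume ne: "y \<noteq> z"
    have "w \<in> E\<^sup>* `` (Z - {z})" if "w \<in> V" for w
    proof -
      obtain x where "x \<in> Z" "(x, w) \<in> E\<^sup>*" using Z(2) \<open>w \<in> V\<close> by blast
      then show ?thesis using yz ne by (cases "x = z") (auto intro: rtrancl_trans)
    qed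
    then have "?P (Z - {z})" using Z(1) by blast
    then have "card Z \<le> card (Z - {z})" by (rule least)
    moreover have "finite Z" using Z(1) assms by (rule finite_subset)
    ultimately show False using yz(2) by (metis card_Diff1_less not_less)
  qed
  with Z show thesis using that by blast
qed

definition depth :: "'a rel \<Rightarrow> 'a set \<Rightarrow> 'a \<Rightarrow> nat" where
  "depth E Z v = (LEAST n. \<exists>z\<in>Z. (z, v) \<in> E ^^ n)"

lemma depth_attained:
  assumes "v \<in> E\<^sup>* `` Z"
  obtains z where "z \<in> Z" "(z, v) \<in> E ^^ depth E Z v"
proof -
  obtain z n where "z \<in> Z" "(z, v) \<in> E ^^ n"
    using assms by (auto dest: rtrancl_imp_relpow)
  then have "\<exists>n. \<exists>z\<in>Z. (z, v) \<in> E ^^ n" by blast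
  from LeastI_ex[OF this] show thesis using that by (auto simp: depth_def)
qed

lemma depth_le: "z \<in> Z \<Longrightarrow> (z, v) \<in> E ^^ n \<Longrightarrow> depth E Z v \<le> n"
  unfolding depth_def by (rule Least_le) blast

lemma ancestor_at_distance:
  assumes "v \<in> E\<^sup>* `` Z" and "k \<le> depth E Z v"
  obtains u where "u \<in> E\<^sup>* `` Z" "(u, v) \<in> E ^^ k" "depth E Z v = depth E Z u + k"
proof -
  let ?n = "depth E Z v"
  obtain z where z: "z \<in> Z" "(z, v) \<in> E ^^ ?n" using assms(1) by (rule depth_attained)
  moreover have "?n = (?n - k) + k" using assms(2) by simp
  ultimately have "(z, v) \<in> E ^^ (?n - k) O E ^^ k" by (metis relpow_add)
  then obtain u where u: "(z, u) \<in> E ^^ (?n - k)" "(u, v) \<in> E ^^ k" by blast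
  have mem: "u \<in> E\<^sup>* `` Z" using u(1) z(1) by (auto intro: relpow_imp_rtrancl)
  have up: "depth E Z u \<le> ?n - k" using z(1) u(1) by (rule depth_le)
  obtain y where "y \<in> Z" "(y, u) \<in> E ^^ depth E Z u" using mem by (rule depth_attained)
  then have "?n \<le> depth E Z u + k"
    using u(2) by (intro depth_le[of y]) (auto simp: relpow_add)
  with up assms(2) have "?n = depth E Z u + k" by linarith
  then show thesis using that mem u(2) by blast
qed

text \<open>Among the last \<open>r\<close> vertices of a shortest path from \<open>Z\<close>, the depth takes every residue.\<close>
lemma ancestor_of_residue:
  assumes "v \<in> E\<^sup>* `` Z" and "r - 1 \<le> depth E Z v" and "i < r"
  obtains u k where "u \<in> E\<^sup>* `` Z" "(u, v) \<in> E ^^ k" "k \<le> r - 1"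
    "depth E Z v = depth E Z u + k" "depth E Z u mod r = i"
proof -
  let ?n = "depth E Z v"
  let ?k = "(?n - i) mod r"
  have i: "i \<le> ?n" using assms(2,3) by linarith
  have "?k < r" using assms(3) by simp
  then have k: "?k \<le> r - 1" "?k \<le> ?n" using assms(2) by linarith+
  from ancestor_at_distance[OF assms(1) k(2)] obtain u
    where u: "u \<in> E\<^sup>* `` Z" "(u, v) \<in> E ^^ ?k" "?n = depth E Z u + ?k" .
  have "?n - i = r * ((?n - i) div r) + ?k" by simp
  then have "depth E Z u = i + r * ((?n - i) div r)" using u(3) i by linarith
  then have "depth E Z u mod r = i" using assms(3) by simp
  then show thesis using that u k(1) by blast
qed

section \<open>A colouring in which every colour reaches every vertex\<close>

text \<open>
  The bound is \<open>(2 * r - 2) + (r - 2)\<close>: from a colour to a root, by way of a deep vertex in its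
  in-ball, and from the root to a vertex too shallow to have \<open>r\<close> ancestors of its own. The colour of a
  vertex is its depth modulo \<open>r\<close>, except on \<open>r\<close> vertices near each root whose in-ball of radius
  \<open>r - 1\<close> is shallow; colouring by depth alone might never bring some colour to such a root.
\<close>
lemma reaching_colouring:
  assumes fin: "finite V" and EV: "E \<subseteq> V \<times> V" and r: "2 \<le> r"
    and closed: "\<And>S. S \<subseteq> V \<Longrightarrow> S \<noteq> {} \<Longrightarrow> E\<inverse> `` S \<subseteq> S \<Longrightarrow> r \<le> card S"
  shows "\<exists>c :: 'a \<Rightarrow> nat. \<forall>v\<in>V. \<forall>i<r. \<exists>u\<in>V. c u = i \<and> reaches_within E (3 * r - 4) u v"
proof -
  obtain Z where Z: "Z \<subseteq> V" "V \<subseteq> E\<^sup>* `` Z"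
    and roots: "\<And>y z. y \<in> Z \<Longrightarrow> z \<in> Z \<Longrightarrow> (y, z) \<in> E\<^sup>* \<Longrightarrow> y = z"
    using independent_roots[OF fin] by metis
  let ?d = "depth E Z"
  \<comment> \<open>The roots \<open>z\<close> with \<open>near z\<close> are those whose in-ball is too shallow for colouring by depth.\<close>
  let ?B = "\<lambda>z. {x. reaches_within E (r - 1) x z}"
  define near where "near z \<longleftrightarrow> z \<in> Z \<and> (\<forall>x\<in>?B z. ?d x < r - 1)" for z

  have "\<exists>T g. T \<subseteq> ?B z \<and> bij_betw g T {..<r}" if "z \<in> Z" for z
  proof -
    have "min r (Suc (r - 1)) \<le> card (?B z)"
      using that Z(1) by (intro card_in_ball[OF fin EV _ closed]) auto
    then have "r \<le> card (?B z)" using r by simp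
    then obtain T where T: "T \<subseteq> ?B z" "card T = r" "finite T"
      by (rule obtain_subset_with_card_n)
    then have "\<exists>g. bij_betw g T {..<r}" by (intro finite_same_card_bij) auto
    with T(1) show ?thesis by blast
  qed
  then obtain T g where T: "\<And>z. z \<in> Z \<Longrightarrow> T z \<subseteq> ?B z"
    and g: "\<And>z. z \<in> Z \<Longrightarrow> bij_betw (g z) (T z) {..<r}"
    by metis

  define c where "c x = (if \<exists>z. near z \<and> x \<in> T z
      then g (THE z. near z \<and> x \<in> T z) x else ?d x mod r)" for x

  have root_unique: "y = z"
    if "y \<in> Z" "z \<in> Z" "(y, x) \<in> E\<^sup>*" "(x, z) \<in> E\<^sup>*" for x y z
    using that roots rtrancl_trans by metis
  have T_reaches: "(x, z) \<in> E\<^sup>*" if "near z" "x \<in> T z" for x z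
    using that T[of z] by (auto simp: near_def intro: reaches_within_imp_rtrancl)
  have T_in_V: "x \<in> V" if "near z" "x \<in> T z" for x z
    using that T[of z] Z(1) reaches_within_source[OF EV, of z] by (auto simp: near_def)
  \<comment> \<open>A vertex that reaches two roots would be reached from a root equal to both.\<close>
  have T_disjoint: "y = z" if y: "near y" "x \<in> T y" and z: "near z" "x \<in> T z" for x y z
  proof -
    obtain w where w: "w \<in> Z" "(w, x) \<in> E\<^sup>*" using T_in_V[OF y] Z(2) by blast
    have "w = y"
      using y(1) root_unique[OF w(1) _ w(2) T_reaches[OF y]] by (simp add: near_def)
    moreover have "w = z"
      using z(1) root_unique[OF w(1) _ w(2) T_reaches[OF z]] by (simp add: near_def)
    ultimately show ?thesis by simp
  qed
  have c_T: "c x = g z x" if "near z" "x \<in> T z" for x z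
  proof -
    have "(THE z. near z \<and> x \<in> T z) = z"
      using that T_disjoint by (intro the_equality) auto
    then show ?thesis using that by (auto simp: c_def)
  qed

  have near_root: "\<exists>u\<in>V. c u = i \<and> reaches_within E (r - 1) u z" if "near z" "i < r" for z i
  proof -
    have "z \<in> Z" using that(1) by (simp add: near_def)
    then have "i \<in> g z ` T z" using g[of z] that(2) by (simp add: bij_betw_def)
    then obtain u where u: "u \<in> T z" "g z u = i" by blast
    then have "reaches_within E (r - 1) u z" using T[OF \<open>z \<in> Z\<close>] by blast
    then show ?thesis using u c_T[OF that(1)] T_in_V[OF that(1)] by blast
  qed

  \<comment> \<open>Colouring by depth serves \<open>v\<close>, unless the required ancestor was recoloured.\<close>
  have deep: "(\<exists>u\<in>V. c u = i \<and> reaches_within E (r - 1) u v) \<or>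
      (\<exists>z x k. near z \<and> x \<in> T z \<and> (x, v) \<in> E ^^ k \<and> k \<le> r - 1)"
    if v: "v \<in> V" and dv: "r - 1 \<le> ?d v" and i: "i < r" for v i
  proof -
    have "v \<in> E\<^sup>* `` Z" using v Z(2) by blast
    from ancestor_of_residue[OF this dv i] obtain u k
      where u: "u \<in> E\<^sup>* `` Z" "(u, v) \<in> E ^^ k" "k \<le> r - 1"
        "?d v = ?d u + k" "?d u mod r = i" .
    show ?thesis
    proof (cases "\<exists>z. near z \<and> u \<in> T z")
      case True
      then show ?thesis using u by blast
    next
      case False
      then have "c u = i" using u(5) by (auto simp: c_def)
      moreover have "reaches_within E (r - 1) u v" using u(2,3) by (rule reaches_withinI)
      ultimately show ?thesis using reaches_within_source[OF EV v] by blast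
    qed
  qed

  \<comment> \<open>Two legs of length \<open>r - 1\<close>: from a colour to a deep vertex \<open>x\<close>, and from \<open>x\<close> to \<open>z\<close>.\<close>
  have far_root: "\<exists>u\<in>V. c u = i \<and> reaches_within E (2 * r - 2) u z"
    if z: "z \<in> Z" and far: "\<not> near z" and i: "i < r" for z i
  proof -
    obtain x where x: "reaches_within E (r - 1) x z" "r - 1 \<le> ?d x"
      using z far by (auto simp: near_def not_less)
    have "x \<in> V" using reaches_within_source[OF EV _ x(1)] z Z(1) by blast
    \<comment> \<open>A recoloured vertex that reaches \<open>x\<close> reaches \<open>z\<close>, so it would belong to the set of \<open>z\<close>.\<close>
    moreover have False if y: "near y" "w \<in> T y" "(w, x) \<in> E ^^ k" for y w k
    proof -
      have wz: "(w, z) \<in> E\<^sup>*"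
        using relpow_imp_rtrancl[OF y(3)] reaches_within_imp_rtrancl[OF x(1)] by (rule rtrancl_trans)
      obtain s where s: "s \<in> Z" "(s, w) \<in> E\<^sup>*" using T_in_V[OF y(1,2)] Z(2) by blast
      have "s = z" by (rule root_unique[OF s(1) z s(2) wz])
      moreover have "s = y"
        using y(1) root_unique[OF s(1) _ s(2) T_reaches[OF y(1,2)]] by (simp add: near_def)
      ultimately show False using far y(1) by simp
    qed
    ultimately obtain u where u: "u \<in> V" "c u = i" "reaches_within E (r - 1) u x"
      using deep[OF _ x(2) i] by blast
    have "reaches_within E ((r - 1) + (r - 1)) u z" using u(3) x(1) by (rule reaches_within_trans)
    moreover have "(r - 1) + (r - 1) = 2 * r - 2" by simp
    ultimately show ?thesis using u(1,2) by metis
  qed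

  have "\<exists>u\<in>V. c u = i \<and> reaches_within E (3 * r - 4) u v" if v: "v \<in> V" and i: "i < r" for v i
  proof (cases "r - 1 \<le> ?d v")
    case False
    have "v \<in> E\<^sup>* `` Z" using v Z(2) by blast
    then obtain z where z: "z \<in> Z" "(z, v) \<in> E ^^ ?d v" by (rule depth_attained)
    have zv: "reaches_within E (r - 2) z v" using z(2) False by (intro reaches_withinI) auto
    obtain u where u: "u \<in> V" "c u = i" "reaches_within E (2 * r - 2) u z"
    proof (cases "near z")
      case True
      obtain u where "u \<in> V" "c u = i" "reaches_within E (r - 1) u z"
        using near_root[OF True i] by blast
      then show thesis using reaches_within_mono[of E "r - 1" u z "2 * r - 2"] that by auto
    next
      case False
      then show thesis using far_root[OF z(1) _ i] that by blast
    qed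
    have "reaches_within E ((2 * r - 2) + (r - 2)) u v" using u(3) zv by (rule reaches_within_trans)
    moreover have "(2 * r - 2) + (r - 2) = 3 * r - 4" using r by simp
    ultimately show ?thesis using u(1,2) by metis
  next
    case True
    from deep[OF v True i] show ?thesis
    proof (elim disjE exE conjE)
      assume "\<exists>u\<in>V. c u = i \<and> reaches_within E (r - 1) u v"
      moreover have "r - 1 \<le> 3 * r - 4" using r by simp
      ultimately show ?thesis by (blast intro: reaches_within_mono)
    next
      fix z x k
      assume z: "near z" and x: "x \<in> T z" and xv: "(x, v) \<in> E ^^ k"
        and k: "k \<le> r - 1"
      have zZ: "z \<in> Z" using z by (simp add: near_def)
      have dx: "?d x < r - 1" using z x T[OF zZ] by (auto simp: near_def)
      have "x \<in> E\<^sup>* `` Z" using T_in_V[OF z x] Z(2) by blast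
      then obtain y where y: "y \<in> Z" "(y, x) \<in> E ^^ ?d x" by (rule depth_attained)
      \<comment> \<open>The root in front of \<open>x\<close> is \<open>z\<close> itself, because \<open>x\<close> reaches \<open>z\<close>; so \<open>z\<close> reaches \<open>v\<close>
        through \<open>x\<close> within \<open>(r - 2) + (r - 1)\<close> steps.\<close>
      have "y = z"
        using y zZ T_reaches[OF z x] by (blast intro: root_unique relpow_imp_rtrancl)
      then have zx: "reaches_within E (?d x) z x" using y(2) by (blast intro: reaches_withinI)
      obtain u where u: "u \<in> V" "c u = i" "reaches_within E (r - 1) u z"
        using near_root[OF z i] by blast
      have "reaches_within E (r - 1 + ?d x + k) u v"
        using u(3) zx reaches_withinI[OF xv order_refl] by (intro reaches_within_trans)
      moreover have "r - 1 + ?d x + k \<le> 3 * r - 4" using dx k by linarith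
      ultimately show ?thesis using u(1,2) by (blast intro: reaches_within_mono)
    qed
  qed
  then show ?thesis by blast
qed

section \<open>Disjoint kernels\<close>

lemma (in wf_digraph) relpow_imp_awalk:
  assumes "(u, v) \<in> arcs_ends G ^^ k" and "v \<in> verts G"
  shows "\<exists>p. awalk u p v \<and> length p = k"
  using assms(1)
proof (induction k arbitrary: u)
  case 0
  then show ?case using assms(2) by (auto simp: awalk_Nil_iff)
next
  case (Suc k)
  then obtain w where w: "(u, w) \<in> arcs_ends G" "(w, v) \<in> arcs_ends G ^^ k"
    by (blast dest: relpow_Suc_D2)
  then obtain p where "awalk w p v" "length p = k" using Suc.IH by blast
  moreover obtain e where "e \<in> arcs G" "tail G e = u" "head G e = w"
    using w(1) by (auto simp: arcs_ends_conv)
  ultimately have "awalk u (e # p) v \<and> length (e # p) = Suc k"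
    by (auto simp: awalk_Cons_iff)
  then show ?case by blast
qed

lemma (in wf_digraph) awalk_imp_short_apath:
  assumes "awalk u p v"
  shows "\<exists>q. apath u q v \<and> length q \<le> length p"
  using assms
proof (induction rule: awalk_to_apath_induct)
  case (path p)
  then show ?case by (auto simp: apath_def)
next
  case (decomp p q r s)
  then show ?case by (auto elim!: awalk_cyc_decompE)
qed

lemma (in wf_digraph) reaches_within_imp_digraph_dist_le:
  assumes "reaches_within (arcs_ends G) n u v" and "v \<in> verts G"
  shows "digraph_dist G u v \<le> enat n"
proof -
  obtain k where "k \<le> n" "(u, v) \<in> arcs_ends G ^^ k" using assms(1) by (auto simp: reaches_within_def)
  then obtain p where "awalk u p v" "length p \<le> n"
    using relpow_imp_awalk[OF _ assms(2)] by blast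
  then obtain q where q: "apath u q v" "length q \<le> n"
    using awalk_imp_short_apath order_trans by blast
  have "digraph_dist G u v \<le> enat (length q)"
    unfolding digraph_dist_def using q(1) by (intro INF_lower) auto
  also have "\<dots> \<le> enat n" using q(2) by simp
  finally show ?thesis .
qed

theorem theorem1p7:
  fixes D :: "('a, 'b) pre_digraph" and r :: nat
  assumes "digraph D"
    and "r \<ge> 2"
    and "\<not> (\<exists>S. source_set D (r - 1) S)"
  shows "\<exists>K :: nat \<Rightarrow> 'a set.
    (\<forall>i<r. q_kernel D (3 * r - 2) (K i)) \<and> disjoint_family_on K {..<r}"
proof -
  interpret digraph D by fact
  let ?V = "verts D" and ?E = "arcs_ends D"
  have EV: "?E \<subseteq> ?V \<times> ?V" by (auto dest: adj_in_verts)
  have irr: "(x, x) \<notin> ?E" for x using adj_not_same by blast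
  have closed: "r \<le> card S" if "S \<subseteq> ?V" "S \<noteq> {}" "?E\<inverse> `` S \<subseteq> S" for S
  proof -
    have "in_nbrs D S = {}" using that(3) by (auto simp: in_nbrs_def)
    then have "\<not> card S \<le> r - 1" using assms(3) that(1,2) by (auto simp: source_set_def)
    then show ?thesis using assms(2) by linarith
  qed
  obtain c :: "'a \<Rightarrow> nat"
    where c: "\<forall>v\<in>?V. \<forall>i<r. \<exists>u\<in>?V. c u = i \<and> reaches_within ?E (3 * r - 4) u v"
    using reaching_colouring[OF finite_verts EV assms(2)] closed by blast
  let ?C = "\<lambda>i. {v \<in> ?V. c v = i}"
  have "\<forall>i. \<exists>K\<subseteq>?C i. (\<forall>u\<in>K. \<forall>v\<in>K. (u, v) \<notin> ?E) \<and> (\<forall>v\<in>?C i. \<exists>u\<in>K. reaches_within ?E 2 u v)"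
    by (intro allI induced_two_kernel irr) simp
  from choice[OF this] obtain K where "\<forall>i. K i \<subseteq> ?C i \<and> (\<forall>u\<in>K i. \<forall>v\<in>K i. (u, v) \<notin> ?E) \<and>
      (\<forall>v\<in>?C i. \<exists>u\<in>K i. reaches_within ?E 2 u v)" ..
  then have K: "\<And>i. K i \<subseteq> ?C i" "\<And>i u v. u \<in> K i \<Longrightarrow> v \<in> K i \<Longrightarrow> (u, v) \<notin> ?E"
      "\<And>i v. v \<in> ?C i \<Longrightarrow> \<exists>u\<in>K i. reaches_within ?E 2 u v"
    by blast+
  have "q_kernel D (3 * r - 2) (K i)" if i: "i < r" for i
  proof -
    have "set_dist D (K i) v \<le> enat (3 * r - 2)" if v: "v \<in> ?V" for v
    proof -
      obtain w where w: "w \<in> ?V" "c w = i" "reaches_within ?E (3 * r - 4) w v" using c v i by blast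
      then obtain u where u: "u \<in> K i" "reaches_within ?E 2 u w" using K(3)[of w i] by blast
      have "reaches_within ?E (2 + (3 * r - 4)) u v" using u(2) w(3) by (rule reaches_within_trans)
      moreover have "2 + (3 * r - 4) = 3 * r - 2" using assms(2) by simp
      ultimately have "digraph_dist D u v \<le> enat (3 * r - 2)"
        using reaches_within_imp_digraph_dist_le[OF _ v] by metis
      moreover have "set_dist D (K i) v \<le> digraph_dist D u v"
        unfolding set_dist_def using u(1) by (rule INF_lower)
      ultimately show ?thesis by (rule order_trans[rotated])
    qed
    then show ?thesis using K(1)[of i] K(2)[of _ i] by (auto simp: q_kernel_def independent_def)
  qed
  moreover have "K i \<inter> K j = {}" if "i \<noteq> j" for i j
    using K(1)[of i] K(1)[of j] that by auto
  then have "disjoint_family_on K {..<r}" by (simp add: disjoint_family_on_def)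
  ultimately show ?thesis by blast
qed

end
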